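(* Let $a>1$ and let $K=\{f\in C[0,\infty):\ \lim_{x\to+\infty}f(x)\ \text{exists and is finite}\}$, regarded as a subspace of the Banach lattice $C_2[0,\infty)$. If $f\in K$, then $\lim_{n\to\infty}S_{n,a}^*(f;x)= f(x)$ uniformly for $x\in[0,\infty)$.
   Context: For $a>1$, $n\in\mathbb{N}=\{1,2,\dots\}$ and $x\ge 0$, the operator $S_{n,a}^*$ is defined by $$S_{n,a}^*(f;x)=\sum_{k=0}^{\infty}a^{\left(\frac{-x}{-1+a^{1/n}}\right)}\frac{(x\log a)^k}{(-1+a^{1/n})^k\,k!}\,f\!\left(\frac{k}{n}\right),$$ for functions $f:[0,\infty)\to\mathbb{R}$ for which the series converges ($\log$ is the natural logarithm, and $0^0=1$). $C_2[0,\infty)$ is the space of $f\in C[0,\infty)$ for which $\lim_{x\to\infty}\frac{f(x)}{1+x^2}$ exists and is finite, with norm $\|f\|=\sup_{x\ge 0}\frac{|f(x)|}{1+x^2}$. *)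

theory Defs
  imports "HOL-Analysis.Analysis"
begin

text \<open>
  A function on \<open>[0,\<infinity>)\<close> is represented by a total function \<open>real \<Rightarrow> real\<close>; its values on the
  negative half-line are never used.
\<close>

definition C2 :: "(real \<Rightarrow> real) set" where
  "C2 = {f. continuous_on {0..} f \<and> (\<exists>l. ((\<lambda>x. f x / (1 + x\<^sup>2)) \<longlongrightarrow> l) at_top)}"

definition K :: "(real \<Rightarrow> real) set" where
  "K = {f. continuous_on {0..} f \<and> (\<exists>l. (f \<longlongrightarrow> l) at_top)}"

lemma K_subset_C2: "K \<subseteq> C2"
proof
  fix f assume "f \<in> K"
  then obtain l where c: "continuous_on {0..} f" and l: "(f \<longlongrightarrow> l) at_top"
    by (auto simp: K_def)
  have "filterlim (\<lambda>x::real. 1 + x\<^sup>2) at_top at_top"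
    by (intro filterlim_tendsto_add_at_top[OF tendsto_const] filterlim_pow_at_top filterlim_ident) auto
  then have "filterlim (\<lambda>x::real. 1 + x\<^sup>2) at_infinity at_top"
    by (rule filterlim_at_top_imp_at_infinity)
  then have "((\<lambda>x. f x / (1 + x\<^sup>2)) \<longlongrightarrow> 0) at_top"
    by (rule tendsto_divide_0[OF l])
  with c show "f \<in> C2" by (auto simp: C2_def)
qed

text \<open>
  The operator \<open>S\<^sub>n\<^sub>,\<^sub>a\<^sup>*\<close>, meant for \<open>a > 1\<close>, \<open>n \<ge> 1\<close> and \<open>x \<ge> 0\<close>. The value of \<^const>\<open>suminf\<close> is
  meaningful only if the series converges; the lemma below shows that it does for every
  function in \<open>K\<close>.
\<close>

definition Sstar_term :: "nat \<Rightarrow> real \<Rightarrow> (real \<Rightarrow> real) \<Rightarrow> real \<Rightarrow> nat \<Rightarrow> real" where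
  "Sstar_term n a f x k =
     a powr (- x / (-1 + a powr (1 / real n))) *
     ((x * ln a) ^ k / ((-1 + a powr (1 / real n)) ^ k * fact k)) *
     f (real k / real n)"

definition Sstar :: "nat \<Rightarrow> real \<Rightarrow> (real \<Rightarrow> real) \<Rightarrow> real \<Rightarrow> real" where
  "Sstar n a f x = (\<Sum>k. Sstar_term n a f x k)"

lemma K_bounded:
  assumes "f \<in> K"
  obtains B where "\<And>x. x \<ge> 0 \<Longrightarrow> \<bar>f x\<bar> \<le> B"
proof -
  from assms obtain l where c: "continuous_on {0..} f" and l: "(f \<longlongrightarrow> l) at_top"
    by (auto simp: K_def)
  from l have "eventually (\<lambda>x. dist (f x) l < 1) at_top"
    by (rule tendstoD) simp
  then obtain M where M: "\<And>x. x \<ge> M \<Longrightarrow> dist (f x) l < 1"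
    by (auto simp: eventually_at_top_linorder)
  have "continuous_on {0..M} f"
    by (rule continuous_on_subset[OF c]) auto
  then have "bounded (f ` {0..M})"
    by (intro compact_imp_bounded compact_continuous_image) auto
  then obtain C where C: "\<And>x. x \<in> {0..M} \<Longrightarrow> \<bar>f x\<bar> \<le> C"
    unfolding bounded_iff by force
  have "\<bar>f x\<bar> \<le> max C (\<bar>l\<bar> + 1)" if "x \<ge> 0" for x
  proof (cases "x \<le> M")
    case True
    then show ?thesis using C[of x] that by auto
  next
    case False
    then show ?thesis using M[of x] by (auto simp: dist_real_def)
  qed
  then show ?thesis by (rule that)
qed

lemma summable_Sstar_term:
  assumes "f \<in> K"
  shows "summable (Sstar_term n a f x)"
proof -
  obtain B where B: "\<And>x. x \<ge> 0 \<Longrightarrow> \<bar>f x\<bar> \<le> B"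
    using K_bounded[OF assms] by blast
  define c where "c = a powr (- x / (-1 + a powr (1 / real n)))"
  define y where "y = x * ln a / (-1 + a powr (1 / real n))"
  have eq: "Sstar_term n a f x k = c * (y ^ k / fact k) * f (real k / real n)" for k
    by (simp add: Sstar_term_def c_def y_def power_divide)
  have "summable (\<lambda>k. \<bar>c\<bar> * B * (\<bar>y\<bar> ^ k / fact k))"
    using summable_exp[of "\<bar>y\<bar>"] by (intro summable_mult) (simp add: field_simps)
  moreover have "norm (Sstar_term n a f x k) \<le> \<bar>c\<bar> * B * (\<bar>y\<bar> ^ k / fact k)" for k
  proof -
    have "\<bar>c\<bar> * (\<bar>y\<bar> ^ k / fact k) * \<bar>f (real k / real n)\<bar> \<le> \<bar>c\<bar> * (\<bar>y\<bar> ^ k / fact k) * B"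
      by (intro mult_left_mono B) auto
    then show ?thesis
      by (simp add: eq abs_mult power_abs mult_ac)
  qed
  ultimately show ?thesis
    by (rule summable_comparison_test'[where N = 0])
qed

end

theory Submission
  imports Defs "HOL-Real_Asymp.Real_Asymp"
begin

text \<open>
  Put \<open>r = x ln a / (a\<^bsup>1/n\<^esup> - 1)\<close>. Then \<open>S\<^sub>n\<^sub>,\<^sub>a\<^sup>* f x\<close> is the expectation of \<open>f (N / n)\<close> for a
  Poisson variable \<open>N\<close> with mean \<open>r\<close>. The node \<open>N / n\<close> has mean \<open>c\<^sub>n x\<close> and variance \<open>c\<^sub>n x / n\<close>,
  where \<open>c\<^sub>n = ln a / (n (a\<^bsup>1/n\<^esup> - 1))\<close> tends to \<open>1\<close>, so its mean square distance from \<open>x\<close>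
  is \<open>c\<^sub>n x / n + (c\<^sub>n - 1)\<^sup>2 x\<^sup>2\<close>. This is not small uniformly in \<open>x\<close>, but it is after division
  by \<open>(1 + x)\<^sup>2\<close>.

  The weight \<open>(1 + x)\<^sup>2\<close> is affordable because a function with a finite limit at infinity is
  uniformly continuous even with respect to the distance of \<open>ln (1 + x)\<close> and \<open>ln (1 + y)\<close>: its
  oscillation is small as soon as \<open>\<bar>y - x\<bar>\<close> is small compared with \<open>1 + x\<close>
  (lemma \<open>K_relative_uniformly_continuous\<close>). As such a function is also bounded, Chebyshev's argument
  gives \<open>\<bar>f y - f x\<bar> \<le> \<epsilon> + C ((y - x) / (1 + x))\<^sup>2\<close> (lemma \<open>K_quadratic_modulus\<close>), and taking the
  expectation over \<open>y = N / n\<close> yields an error bound that does not depend on \<open>x\<close>.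
\<close>

section \<open>Moments of Poisson weights\<close>

definition poisson_weight :: "real \<Rightarrow> nat \<Rightarrow> real" where
  "poisson_weight r k = exp (- r) * (r ^ k / fact k)"

lemma poisson_weight_nonneg: "r \<ge> 0 \<Longrightarrow> poisson_weight r k \<ge> 0"
  by (simp add: poisson_weight_def)

lemma poisson_weight_Suc: "real (Suc k) * poisson_weight r (Suc k) = r * poisson_weight r k"
proof -
  have "(fact (Suc k) :: real) = real (Suc k) * fact k" by simp
  then show ?thesis by (simp add: poisson_weight_def del: of_nat_Suc fact_Suc)
qed

lemma poisson_weight_sums_1: "poisson_weight r sums 1"
proof -
  have "(\<lambda>k. exp (- r) * (r ^ k /\<^sub>R fact k)) sums (exp (- r) * exp r)"
    by (intro sums_mult exp_converges)
  then show ?thesis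
    by (simp add: poisson_weight_def [abs_def] exp_minus divide_inverse mult_ac)
qed

lemma poisson_first_moment: "(\<lambda>k. real k * poisson_weight r k) sums r"
proof -
  have "(\<lambda>k. real (Suc k) * poisson_weight r (Suc k)) sums r"
    unfolding poisson_weight_Suc using sums_mult [OF poisson_weight_sums_1, of r r] by simp
  then show ?thesis by (subst (asm) sums_Suc_iff) simp
qed

lemma poisson_second_moment: "(\<lambda>k. (real k)\<^sup>2 * poisson_weight r k) sums (r\<^sup>2 + r)"
proof -
  have "(\<lambda>k. r * (real k * poisson_weight r k + poisson_weight r k)) sums (r * (r + 1))"
    by (intro sums_mult sums_add poisson_first_moment poisson_weight_sums_1)
  moreover have "r * (real k * poisson_weight r k + poisson_weight r k)
      = (real (Suc k))\<^sup>2 * poisson_weight r (Suc k)" for k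
  proof -
    have "(real (Suc k))\<^sup>2 * poisson_weight r (Suc k)
        = real (Suc k) * (r * poisson_weight r k)"
      unfolding poisson_weight_Suc [symmetric] by (simp only: power2_eq_square mult.assoc)
    then show ?thesis by (simp add: algebra_simps)
  qed
  ultimately have "(\<lambda>k. (real (Suc k))\<^sup>2 * poisson_weight r (Suc k)) sums (r * (r + 1))"
    by simp
  then show ?thesis by (subst (asm) sums_Suc_iff) (simp add: algebra_simps power2_eq_square)
qed

lemma poisson_mean_square_deviation:
  assumes "m \<noteq> 0"
  shows "(\<lambda>k. poisson_weight r k * (real k / m - x)\<^sup>2) sums (r / m\<^sup>2 + (r / m - x)\<^sup>2)"
proof -
  have "(\<lambda>k. (1 / m\<^sup>2) * ((real k)\<^sup>2 * poisson_weight r k)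
           - (2 * x / m) * (real k * poisson_weight r k) + x\<^sup>2 * poisson_weight r k)
        sums ((1 / m\<^sup>2) * (r\<^sup>2 + r) - (2 * x / m) * r + x\<^sup>2 * 1)"
    by (intro sums_add sums_diff sums_mult poisson_second_moment poisson_first_moment
        poisson_weight_sums_1)
  moreover have "(1 / m\<^sup>2) * ((real k)\<^sup>2 * poisson_weight r k)
        - (2 * x / m) * (real k * poisson_weight r k) + x\<^sup>2 * poisson_weight r k
      = poisson_weight r k * (real k / m - x)\<^sup>2" for k
    by (simp add: power2_diff power_divide algebra_simps)
  moreover have "(1 / m\<^sup>2) * (r\<^sup>2 + r) - (2 * x / m) * r + x\<^sup>2 * 1 = r / m\<^sup>2 + (r / m - x)\<^sup>2"
    by (simp add: power2_diff power_divide algebra_simps add_divide_distrib)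
  ultimately show ?thesis by simp
qed

section \<open>Functions with a limit at infinity\<close>

text \<open>
  Far out, \<open>\<bar>y - x\<bar> < (1 + x) / 2\<close> forces \<open>y\<close> to be far out as well, so both values are close to
  the limit; on the remaining bounded range \<open>1 + x\<close> is bounded, and ordinary uniform continuity
  on a compact interval applies.
\<close>

lemma K_relative_uniformly_continuous:
  assumes "f \<in> K" and "e > 0"
  obtains d where "d > 0"
    and "\<And>x y. x \<ge> 0 \<Longrightarrow> y \<ge> 0 \<Longrightarrow> \<bar>y - x\<bar> < d * (1 + x) \<Longrightarrow> \<bar>f y - f x\<bar> < e"
proof -
  from assms obtain l where c: "continuous_on {0..} f" and l: "(f \<longlongrightarrow> l) at_top"
    by (auto simp: K_def)
  have "eventually (\<lambda>x. dist (f x) l < e / 2) at_top"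
    using l assms(2) by (intro tendstoD) auto
  then obtain M0 where M0: "\<And>x. x \<ge> M0 \<Longrightarrow> dist (f x) l < e / 2"
    by (auto simp: eventually_at_top_linorder)
  define M where "M = max M0 0"
  have M: "M \<ge> 0" "\<And>x. x \<ge> M \<Longrightarrow> \<bar>f x - l\<bar> < e / 2"
    using M0 by (auto simp: M_def dist_real_def)
  have "uniformly_continuous_on {0..2 * M + 2} f"
    by (intro compact_uniformly_continuous continuous_on_subset [OF c]) auto
  then obtain d0 where d0: "d0 > 0"
    "\<And>x y. x \<in> {0..2 * M + 2} \<Longrightarrow> y \<in> {0..2 * M + 2} \<Longrightarrow> dist y x < d0 \<Longrightarrow> dist (f y) (f x) < e"
    using assms(2) unfolding uniformly_continuous_on_def by metis
  define d where "d = min (1 / 2) (min 1 d0 / (2 * M + 2))"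
  have d: "d > 0" "d \<le> 1 / 2" "d * (2 * M + 2) \<le> min 1 d0"
  proof -
    show "d > 0" "d \<le> 1 / 2" using d0 M(1) by (auto simp: d_def)
    have "d \<le> min 1 d0 / (2 * M + 2)" by (simp add: d_def)
    then show "d * (2 * M + 2) \<le> min 1 d0"
      using M(1) by (subst (asm) pos_le_divide_eq) auto
  qed
  show ?thesis
  proof (rule that [OF d(1)])
    fix x y :: real
    assume xy: "x \<ge> 0" "y \<ge> 0" and near: "\<bar>y - x\<bar> < d * (1 + x)"
    show "\<bar>f y - f x\<bar> < e"
    proof (cases "x \<le> 2 * M + 1")
      case True
      have "d * (1 + x) \<le> d * (2 * M + 2)"
        using True d(1) by (intro mult_left_mono) auto
      with near d(3) have "\<bar>y - x\<bar> < 1" "\<bar>y - x\<bar> < d0" by linarith+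
      then show ?thesis using d0(2) [of x y] xy True by (auto simp: dist_real_def)
    next
      case False
      have "d * (1 + x) \<le> 1 / 2 * (1 + x)"
        using xy d(2) by (intro mult_right_mono) auto
      with near have "\<bar>y - x\<bar> < 1 / 2 * (1 + x)" by (rule less_le_trans)
      with False have "y \<ge> M" by (simp add: abs_if split: if_splits)
      then show ?thesis using M(1) M(2) [of x] M(2) [of y] False by linarith
    qed
  qed
qed

text \<open>
  Chebyshev's argument: where the oscillation exceeds \<open>e\<close>, the quotient
  \<open>((y - x) / (d * (1 + x)))\<^sup>2\<close> is at least \<open>1\<close>, so that a multiple of it dominates the trivial
  bound on the oscillation.
\<close>

lemma K_quadratic_modulus:
  assumes "f \<in> K" and "e > 0"
  obtains C where "C \<ge> 0"
    and "\<And>x y. x \<ge> 0 \<Longrightarrow> y \<ge> 0 \<Longrightarrow> \<bar>f y - f x\<bar> \<le> e + C * ((y - x)\<^sup>2 / (1 + x)\<^sup>2)"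
proof -
  obtain B where B: "\<And>x. x \<ge> 0 \<Longrightarrow> \<bar>f x\<bar> \<le> B"
    using K_bounded [OF assms(1)] by blast
  have B0: "B \<ge> 0" using B [of 0] by auto
  obtain d where d: "d > 0"
    "\<And>x y. x \<ge> 0 \<Longrightarrow> y \<ge> 0 \<Longrightarrow> \<bar>y - x\<bar> < d * (1 + x) \<Longrightarrow> \<bar>f y - f x\<bar> < e"
    using K_relative_uniformly_continuous [OF assms] by blast
  show ?thesis
  proof (rule that [of "2 * B / d\<^sup>2"])
    show "2 * B / d\<^sup>2 \<ge> 0" using B0 by simp
    fix x y :: real
    assume xy: "x \<ge> 0" "y \<ge> 0"
    show "\<bar>f y - f x\<bar> \<le> e + 2 * B / d\<^sup>2 * ((y - x)\<^sup>2 / (1 + x)\<^sup>2)"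
    proof (cases "\<bar>y - x\<bar> < d * (1 + x)")
      case True
      have "2 * B / d\<^sup>2 * ((y - x)\<^sup>2 / (1 + x)\<^sup>2) \<ge> 0" using B0 by simp
      with d(2) [OF xy True] show ?thesis by linarith
    next
      case False
      then have "(d * (1 + x))\<^sup>2 \<le> \<bar>y - x\<bar>\<^sup>2"
        using xy d(1) by (intro power_mono) auto
      then have "1 \<le> (y - x)\<^sup>2 / (d * (1 + x))\<^sup>2"
        using xy d(1) by (subst pos_le_divide_eq) auto
      then have "2 * B * 1 \<le> 2 * B * ((y - x)\<^sup>2 / (d * (1 + x))\<^sup>2)"
        using B0 by (intro mult_left_mono) auto
      then have "2 * B \<le> 2 * B / d\<^sup>2 * ((y - x)\<^sup>2 / (1 + x)\<^sup>2)"
        by (simp add: power_mult_distrib)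
      moreover have "\<bar>f y - f x\<bar> \<le> 2 * B"
        using B [OF xy(1)] B [OF xy(2)] by linarith
      ultimately show ?thesis using assms(2) by linarith
    qed
  qed
qed

section \<open>The operator as a Poisson expectation\<close>

text \<open>
  This is the \<open>c\<^sub>n\<close> by which the operator scales the identity function: the nodes \<open>k / n\<close>,
  weighted as in \<^const>\<open>Sstar\<close>, have mean \<open>c\<^sub>n x\<close>.
\<close>

definition mean_factor :: "real \<Rightarrow> nat \<Rightarrow> real" where
  "mean_factor a n = ln a / (real n * (a powr (1 / real n) - 1))"

lemma mean_factor_nonneg:
  assumes "a > 1"
  shows "mean_factor a n \<ge> 0"
proof -
  have "a powr (1 / real n) \<ge> 1" using assms by (intro ge_one_powr_ge_zero) auto
  with assms show ?thesis by (auto simp: mean_factor_def)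
qed

lemma mean_factor_tendsto_1:
  assumes "a > 1"
  shows "mean_factor a \<longlonglongrightarrow> 1"
proof -
  have "ln a > 0" using assms by simp
  have "(\<lambda>n. ln a / (real n * (exp (ln a / real n) - 1))) \<longlonglongrightarrow> 1"
    using \<open>ln a > 0\<close> by real_asymp
  then show ?thesis using assms by (simp add: mean_factor_def [abs_def] powr_def)
qed

lemma Sstar_term_eq_poisson_weight:
  assumes "a > 1" and "n > 0"
  shows "Sstar_term n a f x k =
    poisson_weight (real n * mean_factor a n * x) k * f (real k / real n)"
proof -
  have "real n * mean_factor a n * x = x * ln a / (-1 + a powr (1 / real n))"
    using assms by (simp add: mean_factor_def mult_ac)
  then show ?thesis
    using assms by (simp add: Sstar_term_def poisson_weight_def powr_def power_divide)
qed

text \<open>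
  The mean square deviation \<open>x c\<^sub>n / n + x\<^sup>2 (c\<^sub>n - 1)\<^sup>2\<close> grows at most like the denominator
  \<open>(1 + x)\<^sup>2\<close> in the modulus, so \<open>x\<close> cancels from the bound.
\<close>

lemma Sstar_error_bound:
  assumes "a > 1" and "n > 0" and "f \<in> K" and "x \<ge> 0" and "C \<ge> 0"
    and modulus: "\<And>y. y \<ge> 0 \<Longrightarrow> \<bar>f y - f x\<bar> \<le> e + C * ((y - x)\<^sup>2 / (1 + x)\<^sup>2)"
  shows "\<bar>Sstar n a f x - f x\<bar> \<le> e + C * (mean_factor a n / real n + (mean_factor a n - 1)\<^sup>2)"
proof -
  define c where "c = mean_factor a n"
  define r where "r = real n * c * x"
  define w where "w = poisson_weight r"
  have c0: "c \<ge> 0" unfolding c_def by (rule mean_factor_nonneg) fact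
  then have w0: "w k \<ge> 0" for k
    using assms(4) by (simp add: w_def r_def poisson_weight_nonneg)
  have w1: "w sums 1" unfolding w_def by (rule poisson_weight_sums_1)
  have "(\<lambda>k. w k * f (real k / real n)) sums Sstar n a f x"
    using summable_sums [OF summable_Sstar_term [OF assms(3), of n a x]]
    unfolding Sstar_def Sstar_term_eq_poisson_weight [OF assms(1,2), abs_def] w_def r_def c_def .
  from sums_diff [OF this sums_mult2 [OF w1, of "f x"]]
  have diff: "(\<lambda>k. w k * (f (real k / real n) - f x)) sums (Sstar n a f x - f x)"
    by (simp add: algebra_simps)
  have "(\<lambda>k. w k * (real k / real n - x)\<^sup>2) sums (r / (real n)\<^sup>2 + (r / real n - x)\<^sup>2)"
    unfolding w_def using assms(2) by (intro poisson_mean_square_deviation) auto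
  also have "r / (real n)\<^sup>2 + (r / real n - x)\<^sup>2 = x * (c / real n) + x\<^sup>2 * (c - 1)\<^sup>2"
    using assms(2) by (simp add: r_def power2_eq_square field_simps)
  finally have dev: "(\<lambda>k. w k * (real k / real n - x)\<^sup>2) sums
      (x * (c / real n) + x\<^sup>2 * (c - 1)\<^sup>2)" .
  have major: "(\<lambda>k. w k * e + C / (1 + x)\<^sup>2 * (w k * (real k / real n - x)\<^sup>2)) sums
      (1 * e + C / (1 + x)\<^sup>2 * (x * (c / real n) + x\<^sup>2 * (c - 1)\<^sup>2))"
    by (intro sums_add sums_mult sums_mult2 w1 dev)
  have le: "norm (w k * (f (real k / real n) - f x)) \<le>
      w k * e + C / (1 + x)\<^sup>2 * (w k * (real k / real n - x)\<^sup>2)" for k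
  proof -
    have "w k * \<bar>f (real k / real n) - f x\<bar> \<le>
        w k * (e + C * ((real k / real n - x)\<^sup>2 / (1 + x)\<^sup>2))"
      by (intro mult_left_mono modulus w0) auto
    moreover have "norm (w k * (f (real k / real n) - f x)) = w k * \<bar>f (real k / real n) - f x\<bar>"
      using w0 [of k] by (simp add: abs_mult)
    ultimately show ?thesis by (simp add: distrib_left mult_ac)
  qed
  have "\<bar>Sstar n a f x - f x\<bar> \<le> 1 * e + C / (1 + x)\<^sup>2 * (x * (c / real n) + x\<^sup>2 * (c - 1)\<^sup>2)"
    using norm_sums_le [OF diff major le] by (simp only: real_norm_def)
  also have "\<dots> \<le> e + C / (1 + x)\<^sup>2 * ((1 + x)\<^sup>2 * (c / real n) + (1 + x)\<^sup>2 * (c - 1)\<^sup>2)"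
  proof -
    have "x \<le> (1 + x)\<^sup>2" "x\<^sup>2 \<le> (1 + x)\<^sup>2"
      using assms(4) by (auto simp: power2_sum)
    then show ?thesis using assms(5) c0
      by (intro add_mono mult_left_mono mult_right_mono) auto
  qed
  also have "\<dots> = e + C * (c / real n + (c - 1)\<^sup>2)"
  proof -
    have "(1 + x)\<^sup>2 \<noteq> 0" using assms(4) by simp
    then show ?thesis
      unfolding distrib_left [of "(1 + x)\<^sup>2", symmetric] by (simp del: power_eq_0_iff)
  qed
  finally show ?thesis by (simp add: c_def)
qed

theorem theorem4p2:
  fixes a :: real and f :: "real \<Rightarrow> real"
  assumes "a > 1"
    and "f \<in> K"
  shows "uniform_limit {0..} (\<lambda>n x. Sstar n a f x) f sequentially"
proof (rule uniform_limitI)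
  fix e :: real
  assume "e > 0"
  then obtain C where C: "C \<ge> 0"
    "\<And>x y. x \<ge> 0 \<Longrightarrow> y \<ge> 0 \<Longrightarrow> \<bar>f y - f x\<bar> \<le> e / 2 + C * ((y - x)\<^sup>2 / (1 + x)\<^sup>2)"
    using K_quadratic_modulus [OF assms(2), of "e / 2"] by auto
  have "(\<lambda>n. C * (mean_factor a n * (1 / real n) + (mean_factor a n - 1)\<^sup>2))
      \<longlonglongrightarrow> C * (1 * 0 + (1 - 1)\<^sup>2)"
    by (intro tendsto_intros mean_factor_tendsto_1 assms(1) lim_1_over_n)
  then have "(\<lambda>n. C * (mean_factor a n / real n + (mean_factor a n - 1)\<^sup>2)) \<longlonglongrightarrow> 0"
    by simp
  then have "\<forall>\<^sub>F n in sequentially.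
      C * (mean_factor a n / real n + (mean_factor a n - 1)\<^sup>2) < e / 2"
    by (rule order_tendstoD) (use \<open>e > 0\<close> in simp)
  then show "\<forall>\<^sub>F n in sequentially. \<forall>x\<in>{0..}. dist (Sstar n a f x) (f x) < e"
    using eventually_gt_at_top [of 0]
  proof eventually_elim
    case (elim n)
    show ?case
    proof
      fix x :: real
      assume "x \<in> {0..}"
      then have "\<bar>Sstar n a f x - f x\<bar> \<le>
          e / 2 + C * (mean_factor a n / real n + (mean_factor a n - 1)\<^sup>2)"
        using C elim assms by (intro Sstar_error_bound) auto
      with elim(1) show "dist (Sstar n a f x) (f x) < e" unfolding dist_real_def by linarith
    qed
  qed
qed

end
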